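(* Let $A$ be an abelian group, $G$ a connected Lie group, and $\mathcal{D}$ a subset of the variety of representations $A\to G$. Then the pairing $$\nu:A\times\pi_1(\mathcal{D})\to\pi_1(G),\qquad \nu(a,[P]):=[P(a)],$$ is bilinear; that is, for each fixed $a\in A$ the map $[P]\mapsto[P(a)]$ is a homomorphism $\pi_1(\mathcal{D})\to\pi_1(G)$, and for each fixed $[P]\in\pi_1(\mathcal{D})$ the map $a\mapsto[P(a)]$ is a homomorphism $A\to\pi_1(G)$.
   Context: Given a path $P=\{\rho_t,\ 0\le t\le 1\}$ in $\mathcal{D}$ and $a\in A$, $P(a)$ denotes the path $\{\rho_t(a),\ 0\le t\le 1\}$ in $G$. The space of representations $A\to G$ carries its usual topology (pointwise convergence), and $\mathcal{D}$ the subspace topology. If $P$ is a closed path, then $P(a)$ is a closed path in $G$, whose class depends only on $a$ and the homotopy class $[P]$. Since $G$ is a connected topological group, $\pi_1(G)$ is abelian and the fundamental groups of $G$ at different base points are canonically identified, so $[P(a)]$ is regarded as an element of $\pi_1(G)=\pi_1(G,1)$. *)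

theory Defs
  imports "HOL-Analysis.Analysis" "HOL-Algebra.Group"
begin

text \<open>
  The model space of dimension \<open>n\<close> is \<^const>\<open>Euclidean_space\<close> \<open>n\<close>: functions
  \<open>nat \<Rightarrow> real\<close> vanishing from index \<open>n\<close> on.  This also covers \<open>n = 0\<close>, which the class
  \<open>euclidean_space\<close> does not.  In \<open>Ck_on n k W f\<close> and \<open>smooth_on m n W f\<close> the set \<open>W\<close> is meant to be
  open in the model space, so that \<open>f (x(i := t))\<close> only matters for \<open>x(i := t)\<close> in \<open>W\<close>.
\<close>

primrec Ck_on :: "nat \<Rightarrow> nat \<Rightarrow> (nat \<Rightarrow> real) set \<Rightarrow> ((nat \<Rightarrow> real) \<Rightarrow> real) \<Rightarrow> bool" where
  "Ck_on n 0 W f \<longleftrightarrow> continuous_map (subtopology (Euclidean_space n) W) euclideanreal f"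
| "Ck_on n (Suc k) W f \<longleftrightarrow>
     continuous_map (subtopology (Euclidean_space n) W) euclideanreal f \<and>
     (\<forall>i<n. \<exists>g. (\<forall>x\<in>W. ((\<lambda>t. f (x(i := t))) has_real_derivative g x) (at (x i))) \<and> Ck_on n k W g)"

definition smooth_on ::
    "nat \<Rightarrow> nat \<Rightarrow> (nat \<Rightarrow> real) set \<Rightarrow> ((nat \<Rightarrow> real) \<Rightarrow> (nat \<Rightarrow> real)) \<Rightarrow> bool" where
  "smooth_on m n W f \<longleftrightarrow> (\<forall>j<n. \<forall>k. Ck_on m k W (\<lambda>x. f x j))"

type_synonym 'a chart = "'a set \<times> ('a \<Rightarrow> (nat \<Rightarrow> real))"

definition is_chart :: "nat \<Rightarrow> 'a topology \<Rightarrow> 'a chart \<Rightarrow> bool" where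
  "is_chart n T = (\<lambda>(U, \<phi>). openin T U \<and> openin (Euclidean_space n) (\<phi> ` U) \<and>
     homeomorphic_map (subtopology T U) (subtopology (Euclidean_space n) (\<phi> ` U)) \<phi>)"

definition smooth_atlas :: "nat \<Rightarrow> 'a topology \<Rightarrow> 'a chart set \<Rightarrow> bool" where
  "smooth_atlas n T \<A> \<longleftrightarrow>
     (\<forall>c\<in>\<A>. is_chart n T c) \<and> (\<Union>(U, \<phi>)\<in>\<A>. U) = topspace T \<and>
     (\<forall>(U, \<phi>)\<in>\<A>. \<forall>(V, \<psi>)\<in>\<A>. smooth_on n n (\<phi> ` (U \<inter> V)) (\<psi> \<circ> inv_into U \<phi>))"

definition smooth_manifold :: "nat \<Rightarrow> 'a topology \<Rightarrow> 'a chart set \<Rightarrow> bool" where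
  "smooth_manifold n T \<A> \<longleftrightarrow> Hausdorff_space T \<and> second_countable T \<and> smooth_atlas n T \<A>"

definition smooth_map ::
    "nat \<Rightarrow> 'a topology \<Rightarrow> 'a chart set \<Rightarrow> nat \<Rightarrow> 'b topology \<Rightarrow> 'b chart set \<Rightarrow> ('a \<Rightarrow> 'b) \<Rightarrow> bool" where
  "smooth_map m S \<A> n T \<B> f \<longleftrightarrow> continuous_map S T f \<and>
     (\<forall>(U, \<phi>)\<in>\<A>. \<forall>(V, \<psi>)\<in>\<B>. smooth_on m n (\<phi> ` (U \<inter> f -` V)) (\<psi> \<circ> f \<circ> inv_into U \<phi>))"

text \<open>The first \<open>m\<close> coordinates of a product chart come from the first factor.\<close>

definition prod_atlas :: "nat \<Rightarrow> 'a chart set \<Rightarrow> 'b chart set \<Rightarrow> ('a \<times> 'b) chart set" where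
  "prod_atlas m \<A> \<B> =
     {(U \<times> V, \<lambda>(x, y) i. if i < m then \<phi> x i else \<psi> y (i - m)) | U \<phi> V \<psi>.
        (U, \<phi>) \<in> \<A> \<and> (V, \<psi>) \<in> \<B>}"

definition lie_group ::
    "('g, 'm) monoid_scheme \<Rightarrow> 'g topology \<Rightarrow> nat \<Rightarrow> 'g chart set \<Rightarrow> bool" where
  "lie_group G T n \<A> \<longleftrightarrow>
     group G \<and> topspace T = carrier G \<and> smooth_manifold n T \<A> \<and>
     smooth_map (n + n) (prod_topology T T) (prod_atlas n \<A> \<A>) n T \<A> (\<lambda>(x, y). x \<otimes>\<^bsub>G\<^esub> y) \<and>
     smooth_map n T \<A> n T \<A> (\<lambda>x. inv\<^bsub>G\<^esub> x)"

text \<open>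
  Points of a \<^const>\<open>product_topology\<close> are extensional functions, so every homomorphism on \<open>carrier A\<close>
  is represented by exactly one point.
\<close>

definition rep_space ::
    "('a, 'm) monoid_scheme \<Rightarrow> ('g, 'n) monoid_scheme \<Rightarrow> 'g topology \<Rightarrow> ('a \<Rightarrow> 'g) topology" where
  "rep_space A G T = subtopology (product_topology (\<lambda>_. T) (carrier A)) (hom A G)"

text \<open>
  \<^const>\<open>joinpaths\<close>, \<^const>\<open>reversepath\<close> and \<^const>\<open>homotopic_paths\<close> are confined to types of class
  \<open>topological_space\<close>; the following are their analogues for an abstract topology.
\<close>

definition path_join :: "(real \<Rightarrow> 'a) \<Rightarrow> (real \<Rightarrow> 'a) \<Rightarrow> real \<Rightarrow> 'a" where
  "path_join p q = (\<lambda>t. if t \<le> 1/2 then p (2 * t) else q (2 * t - 1))"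

definition path_reverse :: "(real \<Rightarrow> 'a) \<Rightarrow> real \<Rightarrow> 'a" where
  "path_reverse p = (\<lambda>t. p (1 - t))"

definition paths_from_to :: "'a topology \<Rightarrow> 'a \<Rightarrow> 'a \<Rightarrow> (real \<Rightarrow> 'a) set" where
  "paths_from_to X x y = {p. pathin X p \<and> p 0 = x \<and> p 1 = y}"

definition path_homotopic :: "'a topology \<Rightarrow> (real \<Rightarrow> 'a) \<Rightarrow> (real \<Rightarrow> 'a) \<Rightarrow> bool" where
  "path_homotopic X p q \<longleftrightarrow>
     homotopic_with (\<lambda>r. r 0 = p 0 \<and> r 1 = p 1) (top_of_set {0..1}) X p q"

definition path_class :: "'a topology \<Rightarrow> (real \<Rightarrow> 'a) \<Rightarrow> (real \<Rightarrow> 'a) set" where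
  "path_class X p = {q. path_homotopic X p q}"

text \<open>
  Operations on classes are unions over all choices of representatives (and, below, of connecting
  paths).  Such a union is a homotopy class precisely when the choices do not matter, so
  well-definedness is not assumed by these definitions but is part of what is asserted when a result
  is claimed to lie in the carrier of \<open>\<pi>\<^sub>1\<close>.
\<close>

definition fundamental_group :: "'a topology \<Rightarrow> 'a \<Rightarrow> (real \<Rightarrow> 'a) set monoid" where
  "fundamental_group X x =
     \<lparr>carrier = path_class X ` paths_from_to X x x,
      mult = (\<lambda>c d. \<Union>p\<in>c. \<Union>q\<in>d. path_class X (path_join p q)),
      one = path_class X (\<lambda>_. x)\<rparr>"

text \<open>
  The change of base point from \<open>y\<close> to \<open>x\<close>, taken over all paths \<open>\<gamma>\<close> from \<open>x\<close> to \<open>y\<close>; it is the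
  canonical identification of \<open>\<pi>\<^sub>1(X, y)\<close> with \<open>\<pi>\<^sub>1(X, x)\<close> when \<open>X\<close> is path connected with abelian
  fundamental group.
\<close>

definition rebase :: "'a topology \<Rightarrow> 'a \<Rightarrow> 'a \<Rightarrow> (real \<Rightarrow> 'a) set \<Rightarrow> (real \<Rightarrow> 'a) set" where
  "rebase X x y c =
     (\<Union>\<gamma>\<in>paths_from_to X x y. \<Union>p\<in>c.
        path_class X (path_join (path_join \<gamma> p) (path_reverse \<gamma>)))"

text \<open>
  \<open>\<rho>\<close> is the base point in the space of representations, so \<open>[P(a)]\<close> starts out as a class of
  loops at \<open>\<rho> a\<close>.
\<close>

definition rep_pairing ::
    "('g, 'n) monoid_scheme \<Rightarrow> 'g topology \<Rightarrow> ('a \<Rightarrow> 'g) \<Rightarrow> 'a \<Rightarrow> (real \<Rightarrow> 'a \<Rightarrow> 'g) set \<Rightarrow>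
      (real \<Rightarrow> 'g) set" where
  "rep_pairing G T \<rho> a c = rebase T \<one>\<^bsub>G\<^esub> (\<rho> a) (\<Union>P\<in>c. path_class T (\<lambda>t. P t a))"

end

theory Submission
  imports Defs
begin

text \<open>
  For a loop \<open>P\<close> of representations based at \<open>\<rho>\<close>, the loop \<open>P(a)\<close> is based at \<open>\<rho> a\<close>, and the class
  attached to it in \<open>\<pi>\<^sub>1(G, 1)\<close> comes from transport along a path from \<open>1\<close> to \<open>\<rho> a\<close>.  In a topological
  group this transport has an explicit form: it is the class of the translated loop
  \<open>N a t = P t a \<cdot> (\<rho> a)\<inverse>\<close>, whichever connecting path is used (\<open>path_homotopic_transport\<close>,
  \<open>rebase_path_class\<close>).  So the pairing is \<open>(a, [P]) \<mapsto> [N a]\<close> (\<open>rep_pairing_path_class\<close>).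

  Additivity in \<open>[P]\<close> is then immediate, since translation and evaluation commute with joining paths.

  Additivity in \<open>a\<close> rests on two facts about loops at \<open>1\<close>: their join is homotopic to their pointwise
  product (\<open>path_homotopic_join_mult\<close>), and conjugating a loop by a fixed group element does not change
  its class (\<open>path_homotopic_conj\<close>).  As every \<open>P t\<close> is a homomorphism,
  \<open>N (a b) t = P t a \<cdot> P t b \<cdot> (\<rho> b)\<inverse> \<cdot> (\<rho> a)\<inverse> = N a t \<cdot> (\<rho> a \<cdot> N b t \<cdot> (\<rho> a)\<inverse>)\<close>, which is
  homotopic to \<open>N a \<cdot> N b\<close> and so to the join of \<open>N a\<close> and \<open>N b\<close>.

  Joins and transported loops are compared with pointwise products by one device: a concatenation is
  itself a pointwise product of paths with reparametrized time, and the reparametrizations are deformed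
  linearly (\<open>path_homotopic_reparam\<close>, \<open>path_homotopic_mult\<close>).  Connecting paths exist because charts
  make a Lie group locally path connected, so that a connected one is path connected.
\<close>

section \<open>Homotopies of paths in an abstract topology\<close>

text \<open>Values of a path outside the unit interval carry no information, so a homotopy only has to be
  given on the unit square.\<close>

lemma path_homotopic_iff:
  "path_homotopic X p q \<longleftrightarrow>
    (\<exists>h. continuous_map (top_of_set ({0..1::real} \<times> {0..1})) X h \<and>
         (\<forall>t\<in>{0..1}. h (0, t) = p t \<and> h (1, t) = q t) \<and>
         (\<forall>s\<in>{0..1}. h (s, 0) = p 0 \<and> h (s, 1) = p 1))"
proof -
  have "path_homotopic X p q \<longleftrightarrow>
      (\<exists>h. continuous_map (prod_topology (top_of_set {0..1::real}) (top_of_set {0..1})) X h \<and>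
         (\<forall>t\<in>topspace (top_of_set {0..1}). h (0, t) = p t) \<and>
         (\<forall>t\<in>topspace (top_of_set {0..1}). h (1, t) = q t) \<and>
         (\<forall>s\<in>{0..1}. h (s, 0) = p 0 \<and> h (s, 1) = p 1))"
    unfolding path_homotopic_def
    by (rule homotopic_with[where P = "\<lambda>r. r 0 = p 0 \<and> r 1 = p 1"]) simp
  then show ?thesis by (simp add: ball_conj_distrib conj_assoc)
qed

lemma path_homotopicE:
  assumes "path_homotopic X p q"
  obtains h where "continuous_map (top_of_set ({0..1::real} \<times> {0..1})) X h"
    and "\<And>t. t \<in> {0..1} \<Longrightarrow> h (0, t) = p t" and "\<And>t. t \<in> {0..1} \<Longrightarrow> h (1, t) = q t"
    and "\<And>s. s \<in> {0..1} \<Longrightarrow> h (s, 0) = p 0" and "\<And>s. s \<in> {0..1} \<Longrightarrow> h (s, 1) = p 1"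
proof -
  obtain h where "continuous_map (top_of_set ({0..1::real} \<times> {0..1})) X h \<and>
      (\<forall>t\<in>{0..1}. h (0, t) = p t \<and> h (1, t) = q t) \<and>
      (\<forall>s\<in>{0..1}. h (s, 0) = p 0 \<and> h (s, 1) = p 1)"
    using assms unfolding path_homotopic_iff by (rule exE)
  then show thesis by (intro that[of h]) auto
qed

lemma path_homotopicI:
  assumes "continuous_map (top_of_set ({0..1::real} \<times> {0..1})) X h"
    and "\<And>t. t \<in> {0..1} \<Longrightarrow> h (0, t) = p t" and "\<And>t. t \<in> {0..1} \<Longrightarrow> h (1, t) = q t"
    and "\<And>s. s \<in> {0..1} \<Longrightarrow> h (s, 0) = p 0" and "\<And>s. s \<in> {0..1} \<Longrightarrow> h (s, 1) = p 1"
  shows "path_homotopic X p q"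
  unfolding path_homotopic_iff by (rule exI[of _ h]) (use assms in simp)

lemma path_homotopic_endpoints:
  assumes "path_homotopic X p q" shows "q 0 = p 0" "q 1 = p 1"
  using homotopic_with_imp_property[OF assms[unfolded path_homotopic_def]] by auto

lemma path_homotopic_imp_pathin:
  assumes "path_homotopic X p q" shows "pathin X p" "pathin X q"
  using homotopic_with_imp_continuous_maps[OF assms[unfolded path_homotopic_def]]
  by (auto simp: pathin_def)

lemma path_homotopic_refl: "pathin X p \<Longrightarrow> path_homotopic X p p"
  by (simp add: path_homotopic_def pathin_def)

lemma path_homotopic_sym: "path_homotopic X p q \<Longrightarrow> path_homotopic X q p"
  using path_homotopic_endpoints[of X p q]
  by (auto simp: path_homotopic_def dest: homotopic_with_symD)

lemma path_homotopic_trans: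
  "path_homotopic X p q \<Longrightarrow> path_homotopic X q r \<Longrightarrow> path_homotopic X p r"
  using path_homotopic_endpoints[of X p q]
  by (auto simp: path_homotopic_def intro: homotopic_with_trans)

lemma path_homotopic_eq:
  assumes "pathin X p" "\<And>t. t \<in> {0..1} \<Longrightarrow> p t = q t"
  shows "path_homotopic X p q"
  using assms unfolding path_homotopic_def pathin_def
  by (intro homotopic_with_equal) auto

lemma path_homotopic_map:
  assumes "continuous_map X Y f" "path_homotopic X p q"
  shows "path_homotopic Y (\<lambda>t. f (p t)) (\<lambda>t. f (q t))"
proof -
  have "path_homotopic Y (f \<circ> p) (f \<circ> q)"
    using assms unfolding path_homotopic_def
    by (auto intro: homotopic_with_compose_continuous_map_left)
  then show ?thesis by (simp add: comp_def)
qed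

text \<open>The unit interval is convex, so two reparametrizations with the same end points can be deformed into
  each other linearly.\<close>

lemma path_homotopic_reparam:
  assumes p: "pathin X p"
    and "continuous_on {0..1} \<phi>" "\<phi> \<in> {0..1} \<rightarrow> {0..1}"
    and "continuous_on {0..1} \<psi>" "\<psi> \<in> {0..1} \<rightarrow> {0..1}"
    and "\<phi> 0 = \<psi> 0" "\<phi> 1 = \<psi> 1"
  shows "path_homotopic X (\<lambda>t. p (\<phi> t)) (\<lambda>t. p (\<psi> t))"
proof (rule path_homotopicI)
  let ?u = "\<lambda>(s, t). (1 - s) * \<phi> t + s * \<psi> t"
  have "?u \<in> {0..1} \<times> {0..1} \<rightarrow> {0..1}"
  proof (clarify, goal_cases)
    case (1 s t)
    then have "(1 - s) *\<^sub>R \<phi> t + s *\<^sub>R \<psi> t \<in> {0..1}"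
      using assms(3,5) by (intro convexD[OF convex_real_interval(5)]) auto
    then show ?case by simp
  qed
  moreover have "continuous_on ({0..1} \<times> {0..1}) ?u"
    unfolding case_prod_unfold
    by (intro continuous_intros continuous_on_compose2[OF assms(2)]
        continuous_on_compose2[OF assms(4)]) auto
  ultimately have "continuous_map (top_of_set ({0..1::real} \<times> {0..1})) (top_of_set {0..1}) ?u"
    by simp
  then show "continuous_map (top_of_set ({0..1::real} \<times> {0..1})) X (p \<circ> ?u)"
    using p unfolding pathin_def by (rule continuous_map_compose)
qed (use assms in \<open>auto simp: algebra_simps\<close>)

lemma path_homotopic_join:
  assumes "path_homotopic X p p'" "path_homotopic X q q'" "p 1 = q 0"
  shows "path_homotopic X (path_join p q) (path_join p' q')"
proof -
  obtain h where h: "continuous_map (top_of_set ({0..1::real} \<times> {0..1})) X h"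
    "\<And>t. t \<in> {0..1} \<Longrightarrow> h (0, t) = p t" "\<And>t. t \<in> {0..1} \<Longrightarrow> h (1, t) = p' t"
    "\<And>s. s \<in> {0..1} \<Longrightarrow> h (s, 0) = p 0" "\<And>s. s \<in> {0..1} \<Longrightarrow> h (s, 1) = p 1"
    by (rule path_homotopicE[OF assms(1)]) (rule that)
  obtain k where k: "continuous_map (top_of_set ({0..1::real} \<times> {0..1})) X k"
    "\<And>t. t \<in> {0..1} \<Longrightarrow> k (0, t) = q t" "\<And>t. t \<in> {0..1} \<Longrightarrow> k (1, t) = q' t"
    "\<And>s. s \<in> {0..1} \<Longrightarrow> k (s, 0) = q 0" "\<And>s. s \<in> {0..1} \<Longrightarrow> k (s, 1) = q 1"
    by (rule path_homotopicE[OF assms(2)]) (rule that)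
  let ?S = "top_of_set ({0..1::real} \<times> {0..1})"
  let ?H = "\<lambda>x. if snd x \<le> 1/2 then (h \<circ> (\<lambda>x. (fst x, 2 * snd x))) x
                 else (k \<circ> (\<lambda>x. (fst x, 2 * snd x - 1))) x"
  show ?thesis
  proof (rule path_homotopicI)
    show "continuous_map ?S X ?H"
    proof (rule continuous_map_cases_le)
      show "continuous_map ?S euclideanreal snd" "continuous_map ?S euclideanreal (\<lambda>x. 1/2)"
        by (auto intro: continuous_intros)
      show "continuous_map (subtopology ?S {x \<in> topspace ?S. snd x \<le> 1/2}) X
              (h \<circ> (\<lambda>x. (fst x, 2 * snd x)))"
        by (rule continuous_map_compose[OF _ h(1)])
          (auto simp: subtopology_subtopology intro!: continuous_intros)
      show "continuous_map (subtopology ?S {x \<in> topspace ?S. 1/2 \<le> snd x}) X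
              (k \<circ> (\<lambda>x. (fst x, 2 * snd x - 1)))"
        by (rule continuous_map_compose[OF _ k(1)])
          (auto simp: subtopology_subtopology intro!: continuous_intros)
    next
      fix x :: "real \<times> real" assume x: "x \<in> topspace ?S" "snd x = 1/2"
      then have "2 * snd x = 1" "2 * snd x - 1 = 0" by auto
      with x show "(h \<circ> (\<lambda>x. (fst x, 2 * snd x))) x = (k \<circ> (\<lambda>x. (fst x, 2 * snd x - 1))) x"
        using h(5) k(4) assms(3) by auto
    qed
  qed (use h(2-) k(2-) in \<open>auto simp: path_join_def\<close>)
qed

lemma paths_from_toD:
  assumes "p \<in> paths_from_to X x y"
  shows "pathin X p" "p 0 = x" "p 1 = y" "path_homotopic X p p"
  using assms by (auto simp: paths_from_to_def path_homotopic_refl)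

lemma path_homotopic_paths_from_to:
  assumes "p \<in> paths_from_to X x y" "path_homotopic X p q"
  shows "q \<in> paths_from_to X x y"
  using assms path_homotopic_endpoints[OF assms(2)] path_homotopic_imp_pathin[OF assms(2)]
  by (simp add: paths_from_to_def)

lemma path_join_paths_from_to:
  assumes "p \<in> paths_from_to X x y" "q \<in> paths_from_to X y z"
  shows "path_join p q \<in> paths_from_to X x z"
proof -
  have "path_homotopic X (path_join p q) (path_join p q)"
    using assms by (intro path_homotopic_join) (auto simp: paths_from_to_def path_homotopic_refl)
  then have "pathin X (path_join p q)" by (rule path_homotopic_imp_pathin)
  then show ?thesis using assms by (simp add: paths_from_to_def path_join_def)
qed

lemma path_reverse_paths_from_to:
  assumes "p \<in> paths_from_to X x y"
  shows "path_reverse p \<in> paths_from_to X y x"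
proof -
  have "continuous_map (top_of_set {0..1}) (top_of_set {0..1}) (\<lambda>t::real. 1 - t)"
    by (auto intro!: continuous_intros)
  then have "pathin X (p \<circ> (\<lambda>t. 1 - t))"
    using assms unfolding pathin_def paths_from_to_def by (intro continuous_map_compose) auto
  then show ?thesis using assms by (simp add: paths_from_to_def path_reverse_def comp_def)
qed

lemma path_class_eq: "path_homotopic X p q \<Longrightarrow> path_class X p = path_class X q"
  unfolding path_class_def by (blast intro: path_homotopic_trans path_homotopic_sym)

lemma self_in_path_class: "pathin X p \<Longrightarrow> p \<in> path_class X p"
  by (simp add: path_class_def path_homotopic_refl)

lemma path_class_paths_from_to:
  "p \<in> paths_from_to X x y \<Longrightarrow> q \<in> path_class X p \<Longrightarrow> q \<in> paths_from_to X x y"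
  by (auto simp: path_class_def path_homotopic_paths_from_to)

lemma carrier_fundamental_group:
  "carrier (fundamental_group X x) = path_class X ` paths_from_to X x x"
  by (simp add: fundamental_group_def)

text \<open>All members of the union that defines the product are the same class, because joining respects
  homotopy.\<close>

lemma mult_fundamental_group:
  assumes "p \<in> paths_from_to X x x" "q \<in> paths_from_to X x x"
  shows "path_class X p \<otimes>\<^bsub>fundamental_group X x\<^esub> path_class X q = path_class X (path_join p q)"
proof -
  have "path_class X (path_join p' q') = path_class X (path_join p q)"
    if "p' \<in> path_class X p" "q' \<in> path_class X q" for p' q'
    using path_homotopic_join[of X p p' q q'] that assms
    by (intro path_class_eq[OF path_homotopic_sym]) (simp add: path_class_def paths_from_to_def)
  moreover have "path_class X p \<noteq> {}" "path_class X q \<noteq> {}"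
    using assms self_in_path_class unfolding paths_from_to_def by blast+
  ultimately show ?thesis
    unfolding fundamental_group_def monoid.simps by (intro SUP_eq_const)
qed

section \<open>Loops in a path-connected topological group\<close>

text \<open>Path connectedness supplies both the paths along which loops are moved to \<open>\<one>\<close> and the
  deformation of a conjugation into the identity.\<close>

locale path_connected_group = group G for G (structure) +
  fixes T :: "'a topology"
  assumes topspace_T: "topspace T = carrier G"
    and continuous_mult: "continuous_map (prod_topology T T) T (\<lambda>(x, y). x \<otimes> y)"
    and continuous_inv: "continuous_map T T (\<lambda>x. inv x)"
    and path_connected_T: "path_connected_space T"
begin

lemma continuous_map_mult:
  assumes "continuous_map X T f" "continuous_map X T g"
  shows "continuous_map X T (\<lambda>x. f x \<otimes> g x)"
proof -
  have "continuous_map X T ((\<lambda>(x, y). x \<otimes> y) \<circ> (\<lambda>x. (f x, g x)))"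
    using assms continuous_mult
    by (intro continuous_map_compose) (auto simp: continuous_map_pairedI)
  then show ?thesis by (simp add: comp_def)
qed

lemma continuous_map_inv:
  "continuous_map X T f \<Longrightarrow> continuous_map X T (\<lambda>x. inv (f x))"
  using continuous_map_compose[OF _ continuous_inv] by (fastforce simp: comp_def)

lemma paths_nonempty:
  "y \<in> carrier G \<Longrightarrow> \<exists>\<gamma>. \<gamma> \<in> paths_from_to T \<one> y"
  using path_connected_T topspace_T
  by (auto simp: path_connected_space_def paths_from_to_def)

lemma path_closed: "pathin T p \<Longrightarrow> t \<in> {0..1} \<Longrightarrow> p t \<in> carrier G"
  using path_image_subset_topspace topspace_T by fastforce

lemma pathin_mult:
  "pathin T p \<Longrightarrow> pathin T q \<Longrightarrow> pathin T (\<lambda>t. p t \<otimes> q t)"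
  unfolding pathin_def by (rule continuous_map_mult)

lemma path_homotopic_mult:
  assumes "path_homotopic T p p'" "path_homotopic T q q'"
  shows "path_homotopic T (\<lambda>t. p t \<otimes> q t) (\<lambda>t. p' t \<otimes> q' t)"
proof -
  obtain h where h: "continuous_map (top_of_set ({0..1::real} \<times> {0..1})) T h"
    "\<And>t. t \<in> {0..1} \<Longrightarrow> h (0, t) = p t" "\<And>t. t \<in> {0..1} \<Longrightarrow> h (1, t) = p' t"
    "\<And>s. s \<in> {0..1} \<Longrightarrow> h (s, 0) = p 0" "\<And>s. s \<in> {0..1} \<Longrightarrow> h (s, 1) = p 1"
    by (rule path_homotopicE[OF assms(1)]) (rule that)
  obtain k where k: "continuous_map (top_of_set ({0..1::real} \<times> {0..1})) T k"
    "\<And>t. t \<in> {0..1} \<Longrightarrow> k (0, t) = q t" "\<And>t. t \<in> {0..1} \<Longrightarrow> k (1, t) = q' t"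
    "\<And>s. s \<in> {0..1} \<Longrightarrow> k (s, 0) = q 0" "\<And>s. s \<in> {0..1} \<Longrightarrow> k (s, 1) = q 1"
    by (rule path_homotopicE[OF assms(2)]) (rule that)
  show ?thesis
    by (rule path_homotopicI[where h="\<lambda>x. h x \<otimes> k x"])
      (use h k in \<open>auto intro: continuous_map_mult\<close>)
qed

text \<open>One half of the Eckmann--Hilton argument.  Written with both factors running over the whole
  interval, the join is the pointwise product of \<open>p\<close> run fast and then resting at \<open>\<one>\<close> with
  \<open>q\<close> first resting at \<open>\<one>\<close> and then run fast; straightening both parameters gives the product.\<close>

lemma path_homotopic_join_mult:
  assumes p: "p \<in> paths_from_to T \<one> \<one>" and q: "q \<in> paths_from_to T \<one> \<one>"
  shows "path_homotopic T (path_join p q) (\<lambda>t. p t \<otimes> q t)"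
proof -
  note [simp] = paths_from_toD[OF p] paths_from_toD[OF q]
  let ?\<phi> = "\<lambda>t::real. min 1 (2 * t)" and ?\<psi> = "\<lambda>t::real. max 0 (2 * t - 1)"
  have "path_join p q t = p (?\<phi> t) \<otimes> q (?\<psi> t)" if t: "t \<in> {0..1}" for t
  proof (cases "t \<le> 1/2")
    case True
    then show ?thesis
      using t path_closed[of p "2 * t"] by (simp add: path_join_def min_absorb2 max_absorb1)
  next
    case False
    then show ?thesis
      using t path_closed[of q "2 * t - 1"] by (simp add: path_join_def min_absorb1 max_absorb2)
  qed
  then have "path_homotopic T (path_join p q) (\<lambda>t. p (?\<phi> t) \<otimes> q (?\<psi> t))"
    using paths_from_toD(1)[OF path_join_paths_from_to[OF p q]] by (intro path_homotopic_eq)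
  moreover have "path_homotopic T (\<lambda>t. p (?\<phi> t) \<otimes> q (?\<psi> t)) (\<lambda>t. p t \<otimes> q t)"
    by (intro path_homotopic_mult path_homotopic_reparam[where \<psi>="\<lambda>t. t"])
      (auto intro!: continuous_intros)
  ultimately show ?thesis by (rule path_homotopic_trans)
qed

text \<open>Along a path \<open>\<gamma>\<close> from \<open>\<one>\<close> to \<open>g\<close>, the conjugates by \<open>\<gamma> s\<close> deform \<open>q\<close> into its conjugate
  by \<open>g\<close>; they stay based at \<open>\<one>\<close> because \<open>q\<close> starts and ends there.\<close>

lemma path_homotopic_conj:
  assumes q: "q \<in> paths_from_to T \<one> \<one>" and g: "g \<in> carrier G"
  shows "path_homotopic T (\<lambda>t. g \<otimes> q t \<otimes> inv g) q"
proof -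
  obtain \<gamma> where \<gamma>: "\<gamma> \<in> paths_from_to T \<one> g"
    using paths_nonempty[OF g] by blast
  note [simp] = paths_from_toD[OF q] paths_from_toD[OF \<gamma>]
  have c: "continuous_map (top_of_set ({0..1::real} \<times> {0..1})) T (\<lambda>x. \<delta> (u x))"
    if "pathin T \<delta>" "u = fst \<or> u = snd" for \<delta> and u :: "real \<times> real \<Rightarrow> real"
  proof -
    have "continuous_map (top_of_set ({0..1::real} \<times> {0..1})) (top_of_set {0..1}) u"
      using that(2) by (auto intro!: continuous_intros)
    from continuous_map_compose[OF this that(1)[unfolded pathin_def]] show ?thesis
      by (simp add: comp_def)
  qed
  have "path_homotopic T q (\<lambda>t. g \<otimes> q t \<otimes> inv g)"
    by (rule path_homotopicI[where h="\<lambda>x. \<gamma> (fst x) \<otimes> q (snd x) \<otimes> inv (\<gamma> (fst x))"])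
      (auto intro!: continuous_map_mult continuous_map_inv c simp: path_closed[of \<gamma>] path_closed[of q])
  then show ?thesis by (rule path_homotopic_sym)
qed

lemma translate_loop:
  assumes "p \<in> paths_from_to T y y" "y \<in> carrier G"
  shows "(\<lambda>t. p t \<otimes> inv y) \<in> paths_from_to T \<one> \<one>"
  using assms topspace_T by (auto simp: paths_from_to_def intro: pathin_mult)

text \<open>The change of base point is a translation.  With \<open>q t = p t \<otimes> inv y\<close>, the transported loop is
  the pointwise product of \<open>q\<close>, run only while \<open>p\<close> is being traversed, and of \<open>\<gamma>\<close>, run up before
  and down afterwards.  Straightening the parameter of \<open>q\<close> and contracting that of \<open>\<gamma>\<close> to \<open>0\<close> leaves
  \<open>q\<close>.\<close>

lemma path_homotopic_transport:
  assumes p: "p \<in> paths_from_to T y y" and \<gamma>: "\<gamma> \<in> paths_from_to T \<one> y"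
  shows "path_homotopic T (path_join (path_join \<gamma> p) (path_reverse \<gamma>)) (\<lambda>t. p t \<otimes> inv y)"
proof -
  note [simp] = paths_from_toD[OF p] paths_from_toD[OF \<gamma>]
  have y [simp]: "y \<in> carrier G"
    using path_closed[of p 0] by simp
  define q where "q = (\<lambda>t. p t \<otimes> inv y)"
  have q: "q \<in> paths_from_to T \<one> \<one>"
    unfolding q_def using p y by (rule translate_loop)
  note [simp] = paths_from_toD[OF q]
  \<comment> \<open>The nested join runs \<open>\<gamma>\<close> on \<open>[0, 1/4]\<close>, \<open>p\<close> on \<open>[1/4, 1/2]\<close> and the reverse of \<open>\<gamma>\<close> on
    \<open>[1/2, 1]\<close>.\<close>
  let ?\<phi> = "\<lambda>t::real. max 0 (min 1 (4 * t - 1))"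
  let ?\<psi> = "\<lambda>t::real. min (min 1 (4 * t)) (2 - 2 * t)"
  let ?J = "path_join (path_join \<gamma> p) (path_reverse \<gamma>)"
  have "?J t = q (?\<phi> t) \<otimes> \<gamma> (?\<psi> t)" if t: "t \<in> {0..1}" for t
  proof -
    consider "t \<le> 1/4" | "1/4 < t" "t \<le> 1/2" | "1/2 < t" by linarith
    then show ?thesis
    proof cases
      case 1
      then have "?J t = \<gamma> (4 * t)" "?\<phi> t = 0" "?\<psi> t = 4 * t"
        by (auto simp: path_join_def min_def max_def)
      moreover have "\<gamma> (4 * t) \<in> carrier G"
        using 1 t by (intro path_closed) auto
      ultimately show ?thesis by simp
    next
      case 2
      then have "?J t = p (4 * t - 1)" "?\<phi> t = 4 * t - 1" "?\<psi> t = 1"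
        by (auto simp: path_join_def min_def max_def)
      moreover have "p (4 * t - 1) \<in> carrier G"
        using 2 by (intro path_closed) auto
      ultimately show ?thesis by (simp add: q_def m_assoc)
    next
      case 3
      then have "?J t = \<gamma> (2 - 2 * t)" "?\<phi> t = 1" "?\<psi> t = 2 - 2 * t"
        by (auto simp: path_join_def path_reverse_def min_def max_def)
      moreover have "\<gamma> (2 - 2 * t) \<in> carrier G"
        using 3 t by (intro path_closed) auto
      ultimately show ?thesis by simp
    qed
  qed
  moreover have "pathin T ?J"
    using path_join_paths_from_to[OF path_join_paths_from_to[OF \<gamma> p] path_reverse_paths_from_to[OF \<gamma>]]
    by (rule paths_from_toD)
  ultimately have "path_homotopic T ?J (\<lambda>t. q (?\<phi> t) \<otimes> \<gamma> (?\<psi> t))"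
    by (intro path_homotopic_eq) auto
  moreover have "path_homotopic T (\<lambda>t. q (?\<phi> t) \<otimes> \<gamma> (?\<psi> t)) (\<lambda>t. q t \<otimes> \<gamma> 0)"
    by (intro path_homotopic_mult path_homotopic_reparam[where \<psi>="\<lambda>t. t"]
        path_homotopic_reparam[where \<psi>="\<lambda>t. 0"]) (auto intro!: continuous_intros)
  moreover have "path_homotopic T (\<lambda>t. q t \<otimes> \<gamma> 0) q"
    by (intro path_homotopic_eq pathin_mult) (auto simp: path_closed[of q] topspace_T)
  ultimately show ?thesis
    unfolding q_def[symmetric] by (rule path_homotopic_trans[OF path_homotopic_trans])
qed

text \<open>The translate does not involve the connecting path, so the union over all connecting paths is a
  single class; path connectedness makes it nonempty.\<close>

lemma rebase_path_class:
  assumes p: "p \<in> paths_from_to T y y"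
  shows "rebase T \<one> y (path_class T p) = path_class T (\<lambda>t. p t \<otimes> inv y)"
proof -
  have y: "y \<in> carrier G"
    using path_closed[of p 0] p by (simp add: paths_from_to_def)
  have "path_class T (path_join (path_join \<gamma> q) (path_reverse \<gamma>)) = path_class T (\<lambda>t. p t \<otimes> inv y)"
    if \<gamma>: "\<gamma> \<in> paths_from_to T \<one> y" and q: "q \<in> path_class T p" for \<gamma> q
  proof -
    have "path_homotopic T (path_join (path_join \<gamma> q) (path_reverse \<gamma>)) (\<lambda>t. q t \<otimes> inv y)"
      using path_class_paths_from_to[OF p q] \<gamma> by (rule path_homotopic_transport)
    moreover have "path_homotopic T (\<lambda>t. q t \<otimes> inv y) (\<lambda>t. p t \<otimes> inv y)"
      using q y topspace_T unfolding path_class_def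
      by (intro path_homotopic_mult path_homotopic_refl) (auto intro: path_homotopic_sym)
    ultimately show ?thesis by (rule path_class_eq[OF path_homotopic_trans])
  qed
  moreover have "path_class T p \<noteq> {}"
    using p self_in_path_class unfolding paths_from_to_def by blast
  ultimately show ?thesis
    using paths_nonempty[OF y] unfolding rebase_def by (intro SUP_eq_const) auto
qed

end

section \<open>Connected Lie groups are path connected\<close>

text \<open>Local path connectedness is inherited from the model space through the charts.\<close>

lemma smooth_atlas_imp_locally_path_connected:
  assumes "smooth_atlas n T \<A>"
  shows "locally_path_connected_space T"
  unfolding locally_path_connected_space
proof (intro allI impI, elim conjE)
  fix V x assume V: "openin T V" "x \<in> V"
  then have "x \<in> (\<Union>(U, \<phi>)\<in>\<A>. U)"
    using assms openin_subset by (fastforce simp: smooth_atlas_def)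
  then obtain U \<phi> where U: "(U, \<phi>) \<in> \<A>" "x \<in> U" by blast
  then have chart: "openin T U" "openin (Euclidean_space n) (\<phi> ` U)"
    "homeomorphic_map (subtopology T U) (subtopology (Euclidean_space n) (\<phi> ` U)) \<phi>"
    using assms by (auto simp: smooth_atlas_def is_chart_def)
  have "locally_path_connected_space (subtopology (Euclidean_space n) (\<phi> ` U))"
    using locally_path_connected_Euclidean_space chart(2)
    by (rule locally_path_connected_space_open_subset)
  moreover have "subtopology T U homeomorphic_space subtopology (Euclidean_space n) (\<phi> ` U)"
    using chart(3) homeomorphic_map_imp_homeomorphic_space by blast
  ultimately have "locally_path_connected_space (subtopology T U)"
    using homeomorphic_locally_path_connected_space by blast
  moreover have "openin (subtopology T U) (U \<inter> V)"
    using V(1) by (simp add: openin_subtopology_Int2)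
  ultimately obtain W where W: "openin (subtopology T U) W" "path_connectedin (subtopology T U) W"
      "x \<in> W" "W \<subseteq> U \<inter> V"
    unfolding locally_path_connected_space using U(2) V(2) by blast
  then show "\<exists>W. openin T W \<and> path_connectedin T W \<and> x \<in> W \<and> W \<subseteq> V"
    using chart(1) by (metis le_inf_iff openin_trans_full path_connectedin_subtopology)
qed

lemma lie_group_imp_path_connected_group:
  assumes "lie_group G T n \<A>" "connected_space T"
  shows "path_connected_group G T"
proof -
  have "path_connected_space T"
    using assms smooth_atlas_imp_locally_path_connected path_connected_eq_connected_space
    by (auto simp: lie_group_def smooth_manifold_def)
  then show ?thesis
    using assms(1) unfolding path_connected_group_def path_connected_group_axioms_def
    by (simp add: lie_group_def smooth_map_def)
qed

section \<open>The pairing\<close>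

lemma continuous_map_eval_rep:
  assumes "a \<in> carrier A"
  shows "continuous_map (subtopology (rep_space A G T) D) T (\<lambda>r. r a)"
  unfolding rep_space_def
  by (intro continuous_map_from_subtopology continuous_map_product_projection assms)

lemma eval_paths_from_to:
  assumes "P \<in> paths_from_to (subtopology (rep_space A G T) D) \<rho> \<sigma>" "a \<in> carrier A"
  shows "(\<lambda>t. P t a) \<in> paths_from_to T (\<rho> a) (\<sigma> a)"
  using assms pathin_compose[OF _ continuous_map_eval_rep[OF assms(2)]]
  by (fastforce simp: paths_from_to_def comp_def)

lemma path_in_rep_space_hom:
  assumes "pathin (subtopology (rep_space A G T) D) P" "t \<in> {0..1}"
  shows "P t \<in> hom A G"
  using path_image_subset_topspace[OF assms(1)] assms(2) by (auto simp: rep_space_def)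

context path_connected_group
begin

text \<open>The computing form of the pairing: evaluate at \<open>a\<close> and translate back to \<open>\<one>\<close>.  Evaluation is
  continuous for pointwise convergence, so the choice of representative does not matter.\<close>

lemma rep_pairing_path_class:
  assumes P: "P \<in> paths_from_to (subtopology (rep_space A G T) D) \<rho> \<rho>" and a: "a \<in> carrier A"
  shows "rep_pairing G T \<rho> a (path_class (subtopology (rep_space A G T) D) P)
           = path_class T (\<lambda>t. P t a \<otimes> inv \<rho> a)"
proof -
  let ?D = "subtopology (rep_space A G T) D"
  have "path_class T (\<lambda>t. Q t a) = path_class T (\<lambda>t. P t a)" if "Q \<in> path_class ?D P" for Q
    using path_homotopic_map[OF continuous_map_eval_rep[OF a, of G T D], of P Q] that
    by (intro path_class_eq[OF path_homotopic_sym]) (simp add: path_class_def)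
  moreover have "path_class ?D P \<noteq> {}"
    using P self_in_path_class unfolding paths_from_to_def by blast
  ultimately have "(\<Union>Q\<in>path_class ?D P. path_class T (\<lambda>t. Q t a)) = path_class T (\<lambda>t. P t a)"
    by (intro SUP_eq_const)
  then show ?thesis
    unfolding rep_pairing_def by (simp add: rebase_path_class[OF eval_paths_from_to[OF P a]])
qed

lemma normalized_eval_loop:
  assumes P: "P \<in> paths_from_to (subtopology (rep_space A G T) D) \<rho> \<rho>" and a: "a \<in> carrier A"
  shows "(\<lambda>t. P t a \<otimes> inv \<rho> a) \<in> paths_from_to T \<one> \<one>"
  using eval_paths_from_to[OF P a] path_closed[of "\<lambda>t. P t a" 0]
  by (intro translate_loop) (auto simp: paths_from_to_def)

text \<open>Evaluation and translation act on the value at each single time, so they commute with joining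
  paths on the nose.\<close>

lemma rep_pairing_hom_loops:
  assumes a: "a \<in> carrier A"
  shows "rep_pairing G T \<rho> a
           \<in> hom (fundamental_group (subtopology (rep_space A G T) D) \<rho>) (fundamental_group T \<one>)"
proof (rule homI)
  let ?D = "subtopology (rep_space A G T) D"
  let ?N = "\<lambda>P t. P t a \<otimes> inv \<rho> a"
  fix c assume "c \<in> carrier (fundamental_group ?D \<rho>)"
  then obtain P where P: "P \<in> paths_from_to ?D \<rho> \<rho>" and c: "c = path_class ?D P"
    by (auto simp: carrier_fundamental_group)
  show "rep_pairing G T \<rho> a c \<in> carrier (fundamental_group T \<one>)"
    using normalized_eval_loop[OF P a]
    by (simp add: c rep_pairing_path_class[OF P a] carrier_fundamental_group)
  fix d assume "d \<in> carrier (fundamental_group ?D \<rho>)"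
  then obtain Q where Q: "Q \<in> paths_from_to ?D \<rho> \<rho>" and d: "d = path_class ?D Q"
    by (auto simp: carrier_fundamental_group)
  have "?N (path_join P Q) = path_join (?N P) (?N Q)"
    by (auto simp: path_join_def)
  then show "rep_pairing G T \<rho> a (c \<otimes>\<^bsub>fundamental_group ?D \<rho>\<^esub> d)
      = rep_pairing G T \<rho> a c \<otimes>\<^bsub>fundamental_group T \<one>\<^esub> rep_pairing G T \<rho> a d"
    by (simp add: c d mult_fundamental_group[OF P Q] rep_pairing_path_class[OF P a]
        rep_pairing_path_class[OF Q a] rep_pairing_path_class[OF path_join_paths_from_to[OF P Q] a]
        mult_fundamental_group[OF normalized_eval_loop[OF P a] normalized_eval_loop[OF Q a]])
qed

text \<open>Multiplicativity of each \<open>P t\<close> turns the loop for a product into the pointwise product of the two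
  loops, up to a conjugation by \<open>\<rho> a\<close> that comes from moving the base points to \<open>\<one>\<close>.  Conjugation
  is homotopically trivial, and pointwise products are joins.\<close>

lemma rep_pairing_hom_group:
  assumes c: "c \<in> carrier (fundamental_group (subtopology (rep_space A G T) D) \<rho>)"
    and A: "monoid A"
  shows "(\<lambda>a. rep_pairing G T \<rho> a c) \<in> hom A (fundamental_group T \<one>)"
proof -
  let ?D = "subtopology (rep_space A G T) D"
  obtain P where P: "P \<in> paths_from_to ?D \<rho> \<rho>" and c: "c = path_class ?D P"
    using c by (auto simp: carrier_fundamental_group)
  define N where "N = (\<lambda>a t. P t a \<otimes> inv \<rho> a)"
  have N: "N a \<in> paths_from_to T \<one> \<one>" and pairing: "rep_pairing G T \<rho> a c = path_class T (N a)"
    if "a \<in> carrier A" for a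
    unfolding N_def c using P that by (rule normalized_eval_loop, rule rep_pairing_path_class)
  have homP: "P t \<in> hom A G" if "t \<in> {0..1}" for t
    using path_in_rep_space_hom[OF paths_from_toD(1)[OF P] that] .
  have hom\<rho>: "\<rho> \<in> hom A G"
    using homP[of 0] paths_from_toD(2)[OF P] by simp
  show ?thesis
  proof (rule homI)
    fix a assume a: "a \<in> carrier A"
    show "rep_pairing G T \<rho> a c \<in> carrier (fundamental_group T \<one>)"
      using N[OF a] by (simp add: pairing[OF a] carrier_fundamental_group)
    fix b assume b: "b \<in> carrier A"
    have ab: "a \<otimes>\<^bsub>A\<^esub> b \<in> carrier A"
      using A a b by (rule monoid.m_closed)
    have \<rho>ab: "\<rho> a \<in> carrier G" "\<rho> b \<in> carrier G" "\<rho> (a \<otimes>\<^bsub>A\<^esub> b) = \<rho> a \<otimes> \<rho> b"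
      using hom\<rho> a b by (auto simp: hom_def)
    have "N (a \<otimes>\<^bsub>A\<^esub> b) t = N a t \<otimes> (\<rho> a \<otimes> N b t \<otimes> inv \<rho> a)" if t: "t \<in> {0..1}" for t
    proof -
      have "P t a \<in> carrier G" "P t b \<in> carrier G" "P t (a \<otimes>\<^bsub>A\<^esub> b) = P t a \<otimes> P t b"
        using homP[OF t] a b by (auto simp: hom_def)
      moreover have "inv \<rho> a \<otimes> (\<rho> a \<otimes> x) = x" if "x \<in> carrier G" for x
        using \<rho>ab(1) that by (simp flip: m_assoc)
      ultimately show ?thesis using \<rho>ab by (simp add: N_def inv_mult_group m_assoc)
    qed
    then have "path_homotopic T (N (a \<otimes>\<^bsub>A\<^esub> b)) (\<lambda>t. N a t \<otimes> (\<rho> a \<otimes> N b t \<otimes> inv \<rho> a))"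
      using N[OF ab] by (intro path_homotopic_eq) (auto simp: paths_from_to_def)
    moreover have "path_homotopic T \<dots> (\<lambda>t. N a t \<otimes> N b t)"
      using N a b \<rho>ab(1) by (intro path_homotopic_mult path_homotopic_conj paths_from_toD(4)) auto
    moreover have "path_homotopic T \<dots> (path_join (N a) (N b))"
      using N a b by (intro path_homotopic_sym[OF path_homotopic_join_mult]) auto
    ultimately have "path_class T (N (a \<otimes>\<^bsub>A\<^esub> b)) = path_class T (path_join (N a) (N b))"
      by (rule path_class_eq[OF path_homotopic_trans[OF path_homotopic_trans]])
    then show "rep_pairing G T \<rho> (a \<otimes>\<^bsub>A\<^esub> b) c
        = rep_pairing G T \<rho> a c \<otimes>\<^bsub>fundamental_group T \<one>\<^esub> rep_pairing G T \<rho> b c"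
      by (simp add: pairing a b ab mult_fundamental_group N)
  qed
qed

end

theorem proposition3p1:
  fixes A :: "('a, 'm) monoid_scheme"
    and G :: "('g, 'n) monoid_scheme"
    and T :: "'g topology"
    and n :: nat
    and \<A> :: "'g chart set"
    and D :: "('a \<Rightarrow> 'g) set"
    and \<rho> :: "'a \<Rightarrow> 'g"
  assumes "comm_group A"
    and "lie_group G T n \<A>"
    and "connected_space T"
    and "D \<subseteq> topspace (rep_space A G T)"
    and "\<rho> \<in> D"
  defines "\<D> \<equiv> subtopology (rep_space A G T) D"
  shows "(\<forall>a\<in>carrier A.
            (\<lambda>c. rep_pairing G T \<rho> a c)
              \<in> hom (fundamental_group \<D> \<rho>) (fundamental_group T \<one>\<^bsub>G\<^esub>)) \<and>
         (\<forall>c\<in>carrier (fundamental_group \<D> \<rho>).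
            (\<lambda>a. rep_pairing G T \<rho> a c) \<in> hom A (fundamental_group T \<one>\<^bsub>G\<^esub>))"
proof -
  interpret path_connected_group G T
    using assms(2,3) by (rule lie_group_imp_path_connected_group)
  interpret A: comm_group A by fact
  show ?thesis
    unfolding \<D>_def
    by (intro conjI ballI rep_pairing_hom_loops rep_pairing_hom_group A.monoid_axioms)
qed

end
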